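(* Let $E$ be a finite set, $e\in E$, and let $S\subseteq 2^E$ be such that $e$ is a coloop of $S$, i.e. there is $T\subseteq 2^{E\setminus\{e\}}$ with $S=\{X\mid X\in T\}\cup\{X\cup\{e\}\mid X\in T\}$. If $S/e:=\{X\subseteq E\setminus\{e\}\mid X\in S\}$ (which equals $T$) is a powerful set with ground set $E\setminus\{e\}$, then $S$ is a powerful set.
   Context: For a finite ground set $E$, a family $S\subseteq 2^E$ is called a powerful set if for every $X\subseteq E$ the number of members $Y\in S$ with $Y\cap X=\emptyset$ is a power of $2$. *)

theory Defs
  imports Main
begin

definition powerful_set :: "'a set \<Rightarrow> 'a set set \<Rightarrow> bool" where
  "powerful_set E S \<longleftrightarrow>
     finite E \<and> S \<subseteq> Pow E \<and> (\<forall>X\<subseteq>E. \<exists>k::nat. card {Y \<in> S. Y \<inter> X = {}} = 2 ^ k)"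

definition contraction :: "'a set \<Rightarrow> 'a set set \<Rightarrow> 'a \<Rightarrow> 'a set set" where
  "contraction E S e = {X. X \<subseteq> E - {e} \<and> X \<in> S}"

end

theory Submission
  imports Defs
begin

text \<open>\<open>S\<close> consists of two disjoint copies of \<open>T\<close>: the members
  without \<open>e\<close>, which form the contraction, and their translates under
  \<open>insert e\<close>. For a test set \<open>X\<close>, let N count the members of
  \<open>T\<close> avoiding \<open>X - {e}\<close>. If \<open>X\<close> contains \<open>e\<close>,
  only the first copy contributes and the count for \<open>S\<close> is N; otherwise both contribute
  equally and it is 2N. Either way a power of 2 stays a power of 2.\<close>

theorem theorem3:
  fixes E :: "'a set" and e :: 'a and S T :: "'a set set"
  assumes "finite E" and "e \<in> E" and "S \<subseteq> Pow E"
    and "T \<subseteq> Pow (E - {e})"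
    and "S = {X | X. X \<in> T} \<union> {X \<union> {e} | X. X \<in> T}"
  shows "contraction E S e = T \<and>
    (powerful_set (E - {e}) (contraction E S e) \<longrightarrow> powerful_set E S)"
proof (intro conjI impI)
  have S: "S = T \<union> insert e ` T"
    using assms(5) by auto
  have notin: "e \<notin> Y" if "Y \<in> T" for Y
    using assms(4) that by auto
  show contr: "contraction E S e = T"
    unfolding contraction_def S using assms(4) by auto
  assume "powerful_set (E - {e}) (contraction E S e)"
  then have pow: "\<exists>k::nat. card {Y \<in> T. Y \<inter> X = {}} = 2 ^ k" if "X \<subseteq> E - {e}" for X
    using that unfolding contr powerful_set_def by blast
  have "\<exists>k::nat. card {Y \<in> S. Y \<inter> X = {}} = 2 ^ k" if "X \<subseteq> E" for X
  proof -
    let ?A = "{Y \<in> T. Y \<inter> (X - {e}) = {}}"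
    obtain k where k: "card ?A = 2 ^ k"
      using pow[of "X - {e}"] \<open>X \<subseteq> E\<close> by blast
    show ?thesis
    proof (cases "e \<in> X")
      case True
      \<comment> \<open>Every translate meets \<open>X\<close> in \<open>e\<close>, while members of
        \<open>T\<close> miss \<open>e\<close> and so cannot tell \<open>X\<close> from
        \<open>X - {e}\<close>.\<close>
      then have "{Y \<in> S. Y \<inter> X = {}} = ?A"
        unfolding S using notin by auto
      then show ?thesis
        using k by auto
    next
      case False
      \<comment> \<open>Here \<open>X - {e}\<close> is \<open>X\<close>, and adding \<open>e\<close>
        to a set does not affect whether it avoids \<open>X\<close>.\<close>
      then have split: "{Y \<in> S. Y \<inter> X = {}} = ?A \<union> insert e ` ?A"
        unfolding S by auto
      \<comment> \<open>Infinite sets have \<open>card\<close> 0, whereas \<open>2 ^ k\<close> is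
        positive.\<close>
      have "finite ?A"
        using k by (intro card_ge_0_finite) simp
      moreover have "?A \<inter> insert e ` ?A = {}"
        using notin by auto
      moreover have "inj_on (insert e) ?A"
        using notin by (auto simp: inj_on_def insert_ident)
      ultimately have "card {Y \<in> S. Y \<inter> X = {}} = 2 ^ Suc k"
        unfolding split using k by (simp add: card_Un_disjoint card_image)
      then show ?thesis
        by blast
    qed
  qed
  then show "powerful_set E S"
    using assms(1,3) unfolding powerful_set_def by blast
qed

end
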